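(* Let $h_1,h_2,l_1,\alpha_1,\lambda\in\mathbb{C}$ and $t_1,t_2\in\mathbb{C}\setminus\{0\}$. Consider the $q$-difference equation (variant of the singly confluent $q$-hypergeometric equation, type $(1,2)$) $$q^{h_1+h_2-l_1-2\lambda+1/2}t_2(q^{l_1-1/2}t_1-x)g(qx)+(x-q^{h_1+1/2}t_1)(x-q^{h_2+1/2}t_2)g(x/q)$$ $$-\big[q^{\alpha_1}x^2-q^{h_1+h_2-\lambda+1/2}(q^{-h_2}t_1+q^{-h_1}t_2+q^{-l_1}t_2)x+q^{h_1+h_2-\lambda}(q+1)t_1t_2\big]g(x)=0.$$ (i) Let $(i,i')=(1,2)$ or $(2,1)$. Then $$g(x)=x^\lambda\sum_{n=0}^\infty\frac{(q^{\lambda+\alpha_1};q)_n}{(q^{h_i-l_1+1}t_i/t_1;q)_n(q;q)_n}\Big(\frac{q^{h_i+1/2}t_i}{x};q\Big)_n\Big(\frac{x}{q^{h_{i'}-1/2}t_{i'}}\Big)^n$$ $$\Big(=x^\lambda\,{}_2\phi_1\Big(q^{\lambda+\alpha_1},\frac{q^{h_i+1/2}t_i}{x};q^{h_i-l_1+1}t_i/t_1;q,\frac{x}{q^{h_{i'}-1/2}t_{i'}}\Big)\Big)$$ is a formal solution of this equation. (ii) The function $$g(x)=x^{-\alpha_1}\sum_{n=0}^\infty c_n\frac{(q^{\lambda+\alpha_1};q)_n}{(q^{1+h_2-l_1}t_2/t_1;q)_n}\Big(\frac{x}{q^{l_1-1/2}t_1};q\Big)_n\Big(\frac{q^{-\lambda-\alpha_1+h_2+1/2}t_2}{x}\Big)^n,$$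 $$c_n=\sum_{k=0}^nq^{-nk+k^2}\frac{1}{(q^{h_1-l_1+1};q)_k(q;q)_{n-k}(q;q)_k}(q^{h_1-h_2}t_1/t_2)^k$$ is a formal solution of this equation.
   Context: Conventions: $q\in\mathbb{C}\setminus\{0\}$ is not a root of unity, with a fixed choice of $\log q$, and $q^{a}=\exp(a\log q)$. $(\lambda;q)_n=\prod_{j=0}^{n-1}(1-\lambda q^j)$. The basic hypergeometric series is ${}_r\phi_s(a_1,\dots,a_r;b_1,\dots,b_s;q,z)=\sum_{n\ge0}\frac{(a_1;q)_n\cdots(a_r;q)_n}{(b_1;q)_n\cdots(b_s;q)_n(q;q)_n}\big[(-1)^nq^{n(n-1)/2}\big]^{1+s-r}z^n$. Parameters are assumed such that no denominator factor in the displayed series vanishes. Formal solutions: convergence is not considered. For $\mu\in\mathbb{C}$, $x^\mu$ is a symbol with $(q^{\pm1}x)^\mu=q^{\pm\mu}x^\mu$. Each series has the form $x^\mu\sum_{n\ge0}a_n\varphi_n(x)$, where $a_n$ does not depend on $x$ and $\varphi_n$ (the $x$-dependent part of the $n$-th term) is a polynomial of degree $n$ in $x$ or a polynomial of degree $n$ in $1/x$ (here $\varphi_n=(q^{h_i+1/2}t_i/x;q)_n\,x^n$ in (i) and $\varphi_n=(x/(q^{l_1-1/2}t_1);q)_n\,x^{-n}$ in (ii)). It is a formal solution if, substituting termwise into the left-hand side, dividing by $x^\mu$ (and also by $x^2$ when the $\varphi_n$ are polynomials in $1/x$), and expanding each resulting term in the basis $(\varphi_m)_{m\ge0}$, the total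 coefficient of every $\varphi_m$ (a finite sum) is zero. If the series terminates this means it is an exact solution. *)

theory Defs
  imports Complex_Main "HOL-Computational_Algebra.Polynomial"
begin

text \<open>Throughout, \<open>L\<close> is the chosen value of \<open>log q\<close>; it fixes \<open>q\<^sup>a\<close> for complex \<open>a\<close>.\<close>

definition qpow :: "complex \<Rightarrow> complex \<Rightarrow> complex" where
  "qpow L a = exp (a * L)"

definition qpoch :: "complex \<Rightarrow> complex \<Rightarrow> nat \<Rightarrow> complex" where
  "qpoch a q n = (\<Prod>j<n. 1 - a * q ^ j)"

text \<open>The \<open>n\<close>-th term of \<open>\<^sub>r\<phi>\<^sub>s(as; bs; q, z)\<close>, with \<open>r = length as\<close> and \<open>s = length bs\<close>.\<close>

definition basic_hyp_term ::
    "complex list \<Rightarrow> complex list \<Rightarrow> complex \<Rightarrow> complex \<Rightarrow> nat \<Rightarrow> complex" where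
  "basic_hyp_term as bs q z n =
     (\<Prod>a\<leftarrow>as. qpoch a q n) / ((\<Prod>b\<leftarrow>bs. qpoch b q n) * qpoch q q n)
     * ((-1) ^ n * q ^ (n * (n - 1) div 2)) powi (1 + int (length bs) - int (length as))
     * z ^ n"

text \<open>Left-hand side of the equation at \<open>x\<close>; the last three arguments stand for
  \<open>g(qx)\<close>, \<open>g(x/q)\<close> and \<open>g(x)\<close>.\<close>

definition singly_confluent_lhs ::
    "complex \<Rightarrow> complex \<Rightarrow> complex \<Rightarrow> complex \<Rightarrow> complex \<Rightarrow> complex \<Rightarrow> complex \<Rightarrow> complex
     \<Rightarrow> complex \<Rightarrow> complex \<Rightarrow> complex \<Rightarrow> complex \<Rightarrow> complex \<Rightarrow> complex" where
  "singly_confluent_lhs q L h1 h2 l1 \<alpha>1 lam t1 t2 x g_qx g_xq g_x =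
     qpow L (h1 + h2 - l1 - 2 * lam + 1/2) * t2 * (qpow L (l1 - 1/2) * t1 - x) * g_qx
     + (x - qpow L (h1 + 1/2) * t1) * (x - qpow L (h2 + 1/2) * t2) * g_xq
     - (qpow L \<alpha>1 * x\<^sup>2
        - qpow L (h1 + h2 - lam + 1/2)
            * (qpow L (- h2) * t1 + qpow L (- h1) * t2 + qpow L (- l1) * t2) * x
        + qpow L (h1 + h2 - lam) * (q + 1) * t1 * t2) * g_x"

definition graded_in_x :: "(nat \<Rightarrow> complex \<Rightarrow> complex) \<Rightarrow> bool" where
  "graded_in_x \<phi> \<longleftrightarrow>
     (\<forall>n. \<exists>p. degree p = n \<and> (\<forall>x. x \<noteq> 0 \<longrightarrow> \<phi> n x = poly p x))"

definition graded_in_inverse_x :: "(nat \<Rightarrow> complex \<Rightarrow> complex) \<Rightarrow> bool" where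
  "graded_in_inverse_x \<phi> \<longleftrightarrow>
     (\<forall>n. \<exists>p. degree p = n \<and> (\<forall>x. x \<noteq> 0 \<longrightarrow> \<phi> n x = poly p (1 / x)))"

text \<open>Each \<open>T n\<close> is a finite combination \<open>\<Sum>m. e n m \<cdot> \<phi> m\<close> on nonzero \<open>x\<close>, every \<open>m\<close> receives
  contributions from finitely many \<open>n\<close> only, and these contributions cancel.  If \<open>\<phi>\<close> is graded in
  one of the above senses, it is linearly independent and so \<open>e\<close> is uniquely determined.\<close>

definition coefficients_cancel ::
    "(nat \<Rightarrow> complex \<Rightarrow> complex) \<Rightarrow> (nat \<Rightarrow> complex \<Rightarrow> complex) \<Rightarrow> bool" where
  "coefficients_cancel \<phi> T \<longleftrightarrow>
     (\<exists>e :: nat \<Rightarrow> nat \<Rightarrow> complex.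
        (\<forall>n. finite {m. e n m \<noteq> 0} \<and>
             (\<forall>x. x \<noteq> 0 \<longrightarrow> T n x = (\<Sum>m | e n m \<noteq> 0. e n m * \<phi> m x))) \<and>
        (\<forall>m. finite {n. e n m \<noteq> 0} \<and> (\<Sum>n | e n m \<noteq> 0. e n m) = 0))"

text \<open>The result, divided by \<open>x\<^sup>\<mu>\<close>, of substituting the formal term \<open>x\<^sup>\<mu> u(x)\<close> into an equation
  with left-hand side \<open>E\<close>, using \<open>(q\<^sup>\<plusminus>\<^sup>1x)\<^sup>\<mu> = q\<^sup>\<plusminus>\<^sup>\<mu>x\<^sup>\<mu>\<close>.\<close>

definition substituted_term ::
    "complex \<Rightarrow> complex \<Rightarrow> (complex \<Rightarrow> complex \<Rightarrow> complex \<Rightarrow> complex \<Rightarrow> complex)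
     \<Rightarrow> complex \<Rightarrow> (complex \<Rightarrow> complex) \<Rightarrow> complex \<Rightarrow> complex" where
  "substituted_term q L E \<mu> u x =
     E x (qpow L \<mu> * u (q * x)) (qpow L (- \<mu>) * u (x / q)) (u x)"

text \<open>\<open>x\<^sup>\<mu> \<Sum>n. u n x\<close>, whose \<open>n\<close>-th term \<open>u n\<close> has \<open>x\<close>-dependent part \<open>\<phi> n\<close>, is a formal
  solution of the equation with left-hand side \<open>E\<close>.\<close>

definition formal_solution ::
    "complex \<Rightarrow> complex \<Rightarrow> (complex \<Rightarrow> complex \<Rightarrow> complex \<Rightarrow> complex \<Rightarrow> complex)
     \<Rightarrow> complex \<Rightarrow> (nat \<Rightarrow> complex \<Rightarrow> complex) \<Rightarrow> (nat \<Rightarrow> complex \<Rightarrow> complex) \<Rightarrow> bool" where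
  "formal_solution q L E \<mu> \<phi> u \<longleftrightarrow>
     (\<exists>a. \<forall>n x. x \<noteq> 0 \<longrightarrow> u n x = a n * \<phi> n x) \<and>
     (graded_in_x \<phi> \<and>
        coefficients_cancel \<phi> (\<lambda>n. substituted_term q L E \<mu> (u n)) \<or>
      graded_in_inverse_x \<phi> \<and>
        coefficients_cancel \<phi> (\<lambda>n x. substituted_term q L E \<mu> (u n) x / x\<^sup>2))"

end

theory Submission
  imports Defs
begin

text \<open>
  Put \<open>A\<^sub>i = q\<^bsup>h\<^sub>i + 1/2\<^esup> t\<^sub>i\<close>, \<open>B = q\<^bsup>l\<^sub>1 - 1/2\<^esup> t\<^sub>1\<close>, \<open>a = q\<^bsup>\<lambda> + \<alpha>\<^sub>1\<^esup>\<close>. For (i), the equation maps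
  \<open>\<phi>\<^sub>n = \<Prod>j<n. (x - A q\<^sup>j)\<close> (with \<open>A = A\<^sub>i\<close>, \<open>A' = A\<^bsub>i'\<^esub>\<close>, \<open>X = q\<^sup>n\<close>) to
  \<open>(1 - a X)/X x\<^sup>2 \<phi>\<^sub>n - (A'/X) (1 - X) (1 - A X/(B q)) x\<^sup>2 \<phi>\<^bsub>n-1\<^esub>\<close>, so the series telescopes.
  For (ii), in the variable \<open>1/x\<close>, the coefficient of each basis polynomial is a combination of two
  consecutive instances of a three-term recurrence for \<open>c\<^sub>n\<close>. That recurrence comes from
  eliminating \<open>\<Sum>k. q\<^bsup>-k\<^esup> F(n,k)\<close> and \<open>\<Sum>k. q\<^sup>k F(n,k)\<close>, where \<open>c\<^sub>n = \<Sum>k. F(n,k)\<close>, from the contiguity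
  relations between \<open>F(n,k)\<close> and \<open>F(n-1,k)\<close>, \<open>F(n-1,k-1)\<close>.
\<close>

subsection \<open>Termwise cancellation\<close>

text \<open>The coefficient of \<open>\<phi> m\<close> collects contributions from the terms
  \<open>m + 1\<close>, \<open>m\<close>, \<open>m - 1\<close> and \<open>m - 2\<close>; for
  \<open>m = 0\<close> and \<open>m = 1\<close> some of these do not exist. \<open>w0 0 = 0\<close>
  neutralises the truncated index \<open>0 - 1 = 0\<close>.\<close>

lemma coefficients_cancelI:
  fixes \<phi> T :: "nat \<Rightarrow> complex \<Rightarrow> complex" and w0 w1 w2 w3 :: "nat \<Rightarrow> complex"
  assumes T: "\<And>n x. x \<noteq> 0 \<Longrightarrow> T n x =
      w0 n * \<phi> (n - 1) x + w1 n * \<phi> n x + w2 n * \<phi> (n + 1) x + w3 n * \<phi> (n + 2) x"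
    and w0: "w0 0 = 0"
    and cancel0: "w0 1 + w1 0 = 0"
    and cancel1: "w0 2 + w1 1 + w2 0 = 0"
    and cancel: "\<And>n. w0 (n + 3) + w1 (n + 2) + w2 (n + 1) + w3 n = 0"
  shows "coefficients_cancel \<phi> T"
proof -
  define e where "e n m = (if n = m + 1 then w0 n else 0) + (if n = m then w1 n else 0)
     + (if m = n + 1 then w2 n else 0) + (if m = n + 2 then w3 n else 0)" for n m
  have row: "{m. e n m \<noteq> 0} \<subseteq> {..n + 2}" and col: "{n. e n m \<noteq> 0} \<subseteq> {..m + 1}" for n m
    by (auto simp: e_def split: if_splits)
  have "T n x = (\<Sum>m | e n m \<noteq> 0. e n m * \<phi> m x)" if "x \<noteq> 0" for n x
  proof -
    have "(\<Sum>m | e n m \<noteq> 0. e n m * \<phi> m x) = (\<Sum>m\<le>n + 2. e n m * \<phi> m x)"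
      using row by (intro sum.mono_neutral_left) auto
    also have "\<dots> = (\<Sum>m\<le>n + 2. (if n = m + 1 then w0 n * \<phi> m x else 0))
        + (\<Sum>m\<le>n + 2. (if m = n then w1 n * \<phi> m x else 0))
        + (\<Sum>m\<le>n + 2. (if m = n + 1 then w2 n * \<phi> m x else 0))
        + (\<Sum>m\<le>n + 2. (if m = n + 2 then w3 n * \<phi> m x else 0))"
      unfolding sum.distrib[symmetric] by (rule sum.cong) (auto simp: e_def algebra_simps)
    also have "(\<Sum>m\<le>n + 2. (if n = m + 1 then w0 n * \<phi> m x else 0)) = w0 n * \<phi> (n - 1) x"
      using w0 by (cases n) simp_all
    finally show ?thesis
      using T[OF that] by simp
  qed
  moreover have "(\<Sum>n | e n m \<noteq> 0. e n m) = 0" for m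
  proof -
    have "(\<Sum>n | e n m \<noteq> 0. e n m) = (\<Sum>n\<le>m + 1. e n m)"
      using col by (intro sum.mono_neutral_left) auto
    also have "\<dots> = (\<Sum>n\<le>m + 1. (if n = m + 1 then w0 n else 0))
        + (\<Sum>n\<le>m + 1. (if n = m then w1 n else 0))
        + (\<Sum>n\<le>m + 1. (if m = n + 1 then w2 n else 0))
        + (\<Sum>n\<le>m + 1. (if m = n + 2 then w3 n else 0))"
      unfolding sum.distrib[symmetric] by (rule sum.cong) (auto simp: e_def)
    also have "\<dots> = 0"
    proof -
      consider "m = 0" | "m = 1" | k where "m = k + 2"
        by (metis One_nat_def add_2_eq_Suc' not0_implies_Suc)
      then show ?thesis
      proof cases
        case 1
        then show ?thesis using cancel0 by simp
      next
        case 2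
        then show ?thesis using cancel1 by (simp add: numeral_2_eq_2)
      next
        case 3
        then show ?thesis using cancel[of k] by (simp add: numeral_3_eq_3 numeral_2_eq_2 add_ac)
      qed
    qed
    finally show ?thesis .
  qed
  moreover have "finite {m. e n m \<noteq> 0}" "finite {m. e m n \<noteq> 0}" for n
    using row col by (meson finite_atMost finite_subset)+
  ultimately show ?thesis
    unfolding coefficients_cancel_def by blast
qed

subsection \<open>Shifted products and q-powers\<close>

text \<open>The monic form \<open>y ^ n * qpoch (c / y) q n\<close> of a q-Pochhammer symbol,
  meaningful also at \<open>y = 0\<close>. It serves both parts: \<open>y = x\<close>,
  \<open>c = A\<close> in (i) and \<open>y = 1 / x\<close>, \<open>c = 1 / B\<close> in
  (ii).\<close>

definition shifted_prod :: "complex \<Rightarrow> complex \<Rightarrow> nat \<Rightarrow> complex \<Rightarrow> complex" where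
  "shifted_prod c q n y = (\<Prod>j<n. y - c * q ^ j)"

lemma shifted_prod_0 [simp]: "shifted_prod c q 0 y = 1"
  by (simp add: shifted_prod_def)

lemma shifted_prod_Suc: "shifted_prod c q (Suc n) y = (y - c * q ^ n) * shifted_prod c q n y"
  by (simp add: shifted_prod_def)

text \<open>The dilation moves each zero \<open>c * q ^ j\<close> one step down, so all zeros except
  the new one \<open>c / q\<close> are those of the product of length \<open>n\<close>.\<close>

lemma shifted_prod_mult_q:
  assumes "q \<noteq> 0"
  shows "shifted_prod c q (Suc n) (q * y) = q ^ Suc n * (y - c / q) * shifted_prod c q n y"
proof (induction n)
  case (Suc n)
  show ?case
    by (subst shifted_prod_Suc, subst Suc.IH)
      (use assms in \<open>simp add: shifted_prod_Suc field_simps\<close>)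
qed (use assms in \<open>simp add: shifted_prod_Suc field_simps\<close>)

text \<open>The zeros move one step up; the factor \<open>y - c\<close> restores the missing first
  one.\<close>

lemma shifted_prod_div_q:
  assumes "q \<noteq> 0"
  shows "(y - c) * shifted_prod c q n (y / q) = shifted_prod c q (Suc n) y / q ^ n"
proof (induction n)
  case (Suc n)
  have "(y - c) * shifted_prod c q (Suc n) (y / q)
      = (y / q - c * q ^ n) * ((y - c) * shifted_prod c q n (y / q))"
    by (simp add: shifted_prod_Suc)
  also have "\<dots> = (y / q - c * q ^ n) * (shifted_prod c q (Suc n) y / q ^ n)"
    by (simp only: Suc.IH)
  also have "\<dots> = shifted_prod c q (Suc (Suc n)) y / q ^ Suc n"
    using assms by (simp add: shifted_prod_Suc field_simps)
  finally show ?case .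
qed (simp add: shifted_prod_Suc)

lemma shifted_prod_poly:
  "\<exists>p. degree p = n \<and> (\<forall>y. shifted_prod c q n y = poly p y)"
proof (intro exI conjI allI)
  let ?p = "\<Prod>j<n. [:- (c * q ^ j), 1:]"
  show "degree ?p = n"
    by (subst degree_prod_eq_sum_degree) auto
  show "shifted_prod c q n y = poly ?p y" for y
    by (simp add: shifted_prod_def poly_prod)
qed

lemma qpoch_Suc: "qpoch a q (Suc n) = qpoch a q n * (1 - a * q ^ n)"
  by (simp add: qpoch_def)

lemma qpoch_0 [simp]: "qpoch a q 0 = 1"
  by (simp add: qpoch_def)

lemma qpoch_divide_mult_power:
  assumes "x \<noteq> 0"
  shows "qpoch (c / x) q n * x ^ n = shifted_prod c q n x"
  by (induction n) (use assms in \<open>simp_all add: qpoch_Suc shifted_prod_Suc field_simps\<close>)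

lemma qpoch_neq_0_factor:
  assumes "\<And>n. qpoch b q n \<noteq> 0"
  shows "1 - b * q ^ n \<noteq> 0"
  using assms[of "Suc n"] by (simp add: qpoch_Suc)

lemma qpow_add: "qpow L (a + b) = qpow L a * qpow L b"
  by (simp add: qpow_def exp_add distrib_right)

lemma qpow_diff: "qpow L (a - b) = qpow L a / qpow L b"
  by (simp add: qpow_def exp_diff left_diff_distrib)

lemma qpow_minus: "qpow L (- a) = 1 / qpow L a"
  by (simp add: qpow_def exp_minus field_simps)

lemma qpow_nonzero [simp]: "qpow L a \<noteq> 0"
  by (simp add: qpow_def)

lemma qpow_of_nat: "qpow L (of_nat n) = exp L ^ n"
  by (simp add: qpow_def exp_of_nat_mult)

lemma qpow_1: "qpow L 1 = exp L"
  by (simp add: qpow_def)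

lemma qpow_half: "qpow L (1/2) * qpow L (1/2) = exp L"
  by (simp add: qpow_def exp_add[symmetric])

subsection \<open>The action of the equation on shifted products\<close>

text \<open>
  The left-hand side of the equation, with \<open>Q = q\<^sup>\<lambda>\<close>, \<open>P = q\<^bsup>\<alpha>\<^sub>1\<^esup>\<close> and, for \<open>(i, i') = (1, 2)\<close> or \<open>(2, 1)\<close>,
  \<open>A = q\<^bsup>h\<^sub>i + 1/2\<^esup> t\<^sub>i\<close>, \<open>A' = q\<^bsup>h\<^sub>i\<^sub>' + 1/2\<^esup> t\<^sub>i\<^sub>'\<close>, \<open>B = q\<^bsup>l\<^sub>1 - 1/2\<^esup> t\<^sub>1\<close>.
\<close>

definition reduced_lhs :: "complex \<Rightarrow> complex \<Rightarrow> complex \<Rightarrow> complex \<Rightarrow> complex \<Rightarrow> complex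
     \<Rightarrow> complex \<Rightarrow> complex \<Rightarrow> complex \<Rightarrow> complex \<Rightarrow> complex" where
  "reduced_lhs q Q P A A' B x g_qx g_xq g_x =
     A * A' / (q * B * Q\<^sup>2) * (B - x) * g_qx + (x - A) * (x - A') * g_xq
     - (P * x\<^sup>2 - (A + A' + A * A' / (q * B)) / Q * x + (1 + 1 / q) * A * A' / Q) * g_x"

lemma reduced_lhs_commute: "reduced_lhs q Q P A A' B = reduced_lhs q Q P A' A B"
  by (simp add: reduced_lhs_def fun_eq_iff algebra_simps)

lemma singly_confluent_lhs_eq_reduced:
  assumes "exp L = q" "t1 \<noteq> 0"
  shows "singly_confluent_lhs q L h1 h2 l1 \<alpha>1 lam t1 t2
    = reduced_lhs q (qpow L lam) (qpow L \<alpha>1)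
        (qpow L (h1 + 1/2) * t1) (qpow L (h2 + 1/2) * t2) (qpow L (l1 - 1/2) * t1)"
proof -
  \<comment> \<open>Half-integer exponents enter through a square root \<open>s\<close> of
    \<open>q\<close>, which turns the three coefficient comparisons into rational
    identities.\<close>
  define s where "s = qpow L (1/2)"
  have s: "s \<noteq> 0" and q: "q = s * s"
    using assms qpow_half[of L] by (simp_all add: s_def)
  have lam2: "qpow L (2 * lam) = qpow L lam * qpow L lam"
    by (simp add: qpow_add[symmetric])
  have 1: "qpow L (h1 + h2 - l1 - 2 * lam + 1/2) * t2 =
      (qpow L (h1 + 1/2) * t1) * (qpow L (h2 + 1/2) * t2)
        / (q * (qpow L (l1 - 1/2) * t1) * (qpow L lam)\<^sup>2)"
    using s assms(2)
    unfolding qpow_add qpow_diff lam2 s_def[symmetric] q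
    by (simp add: field_simps power2_eq_square)
  have 2: "qpow L (h1 + h2 - lam + 1/2)
      * (qpow L (- h2) * t1 + qpow L (- h1) * t2 + qpow L (- l1) * t2) =
      (qpow L (h1 + 1/2) * t1 + qpow L (h2 + 1/2) * t2
       + (qpow L (h1 + 1/2) * t1) * (qpow L (h2 + 1/2) * t2)
           / (q * (qpow L (l1 - 1/2) * t1))) / qpow L lam"
    using s assms(2)
    unfolding qpow_add qpow_diff qpow_minus s_def[symmetric] q
    by (simp add: field_simps)
  have 3: "qpow L (h1 + h2 - lam) * (q + 1) * t1 * t2 =
      (1 + 1 / q) * (qpow L (h1 + 1/2) * t1) * (qpow L (h2 + 1/2) * t2) / qpow L lam"
    using s unfolding qpow_add qpow_diff s_def[symmetric] q
    by (simp add: field_simps)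
  show ?thesis
    unfolding fun_eq_iff singly_confluent_lhs_def reduced_lhs_def 1 2 3 by simp
qed

text \<open>The prefix \<open>x^lam\<close> weights \<open>g(qx)\<close> and \<open>g(x/q)\<close>
  by \<open>Q\<close> and \<open>1 / Q\<close>; once \<open>1 / Q\<close> is extracted,
  \<open>Q\<close> and \<open>P\<close> occur only in the product \<open>Q * P\<close>.\<close>

lemma reduced_lhs_scaled:
  assumes "Q \<noteq> 0" "q \<noteq> 0" "B \<noteq> 0"
  shows "reduced_lhs q Q P A A' B x (Q * f) (g / Q) k =
    (A * A' / (q * B) * (B - x) * f + (x - A) * (x - A') * g
     - (Q * P * x\<^sup>2 - (A + A' + A * A' / (q * B)) * x + (1 + 1 / q) * A * A') * k) / Q"
  using assms by (simp add: reduced_lhs_def field_simps power2_eq_square)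

text \<open>Here the prefix is \<open>x^(-\<alpha>1)\<close>, with weights \<open>1 / P\<close> and
  \<open>P\<close>; division by \<open>x\<^sup>2\<close> makes all coefficients polynomials in
  \<open>1 / x\<close>.\<close>

lemma reduced_lhs_scaled_inverse:
  assumes "Q \<noteq> 0" "P \<noteq> 0" "q \<noteq> 0" "B \<noteq> 0" "x \<noteq> 0"
  shows "reduced_lhs q Q P A A' B x (f / P) (P * g) k / x\<^sup>2 =
    (A * A' / (q * (Q * P)) * (1 / x) * (1 / x - 1 / B) * f
     + Q * P * (1 - A * (1 / x)) * (1 - A' * (1 / x)) * g
     - (Q * P - (A + A' + A * A' * (1 / B) / q) * (1 / x)
        + (1 + 1 / q) * A * A' * (1 / x)\<^sup>2) * k) / Q"
  using assms by (simp add: reduced_lhs_def field_simps power2_eq_square)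

text \<open>For \<open>n > 0\<close> all three summands contain the factor
  \<open>\<phi> (n - 1) x\<close>, the middle one thanks to its coefficient \<open>x - A\<close>.
  Dividing it out leaves an identity of cubics in \<open>x\<close> whose constant and linear
  coefficients cancel. For \<open>n = 0\<close> the factor \<open>1 - X\<close> vanishes.\<close>

lemma lhs_shifted_prod:
  fixes n :: nat and q a A A' B x :: complex
  assumes "q \<noteq> 0" "B \<noteq> 0"
  defines "\<phi> \<equiv> shifted_prod A q" and "X \<equiv> q ^ n"
  shows "A * A' / (q * B) * (B - x) * \<phi> n (q * x) + (x - A) * (x - A') * \<phi> n (x / q)
     - (a * x\<^sup>2 - (A + A' + A * A' / (q * B)) * x + (1 + 1 / q) * A * A') * \<phi> n x
   = (1 - a * X) / X * x\<^sup>2 * \<phi> n x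
     - A' / X * (1 - X) * (1 - A / B * X / q) * x\<^sup>2 * \<phi> (n - 1) x"
proof (cases n)
  case 0
  then show ?thesis
    using assms(1,2) by (simp add: \<phi>_def X_def field_simps power2_eq_square)
next
  case (Suc m)
  define Y where "Y = q ^ m"
  have Y: "Y \<noteq> 0" and X: "X = q * Y"
    using assms(1) Suc by (simp_all add: Y_def X_def)
  have 1: "\<phi> n (q * x) = q * Y * (x - A / q) * \<phi> m x"
    using shifted_prod_mult_q[OF assms(1), of A m x] by (simp add: \<phi>_def Y_def Suc)
  have 2: "(x - A) * \<phi> n (x / q) = (x - A * q * Y) * (x - A * Y) * \<phi> m x / (q * Y)"
    using shifted_prod_div_q[OF assms(1), of x A n]
    by (simp add: \<phi>_def Y_def Suc shifted_prod_Suc mult_ac)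
  have 3: "\<phi> n x = (x - A * Y) * \<phi> m x"
    by (simp add: \<phi>_def Y_def Suc shifted_prod_Suc)
  have "A * A' / (q * B) * (B - x) * \<phi> n (q * x) + (x - A) * (x - A') * \<phi> n (x / q)
     - (a * x\<^sup>2 - (A + A' + A * A' / (q * B)) * x + (1 + 1 / q) * A * A') * \<phi> n x
    = A * A' / (q * B) * (B - x) * \<phi> n (q * x) + (x - A') * ((x - A) * \<phi> n (x / q))
     - (a * x\<^sup>2 - (A + A' + A * A' / (q * B)) * x + (1 + 1 / q) * A * A') * \<phi> n x"
    by (simp add: mult_ac)
  also have "\<dots> = (A * A' / (q * B) * (B - x) * (q * Y * (x - A / q))
     + (x - A') * ((x - A * q * Y) * (x - A * Y) / (q * Y))
     - (a * x\<^sup>2 - (A + A' + A * A' / (q * B)) * x + (1 + 1 / q) * A * A') * (x - A * Y)) * \<phi> m x"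
    unfolding 1 2 3 by (simp add: distrib_right left_diff_distrib mult.assoc)
  also have "(A * A' / (q * B) * (B - x) * (q * Y * (x - A / q))
     + (x - A') * ((x - A * q * Y) * (x - A * Y) / (q * Y))
     - (a * x\<^sup>2 - (A + A' + A * A' / (q * B)) * x + (1 + 1 / q) * A * A') * (x - A * Y))
    = ((1 - a * X) / X * (x - A * Y) - A' / X * (1 - X) * (1 - A / B * X / q)) * x\<^sup>2"
    unfolding X using assms(1,2) Y by (simp add: field_simps power2_eq_square)
  finally show ?thesis
    unfolding 3 by (simp add: Suc algebra_simps)
qed

text \<open>Two applications of
  \<open>y * \<phi> n = \<phi> (n + 1) + c * q ^ n * \<phi> n\<close>.\<close>

lemma square_mult_shifted_prod:
  "y\<^sup>2 * shifted_prod c q n y = shifted_prod c q (n + 2) y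
     + c * (1 + q) * q ^ n * shifted_prod c q (n + 1) y + c\<^sup>2 * (q ^ n)\<^sup>2 * shifted_prod c q n y"
  by (simp add: shifted_prod_Suc algebra_simps power2_eq_square)

text \<open>The analogue of \<open>lhs_shifted_prod\<close> for \<open>y = 1 / x\<close> and
  \<open>p = 1 / B\<close>: dividing out \<open>\<phi> (n - 1) y\<close> again leaves a polynomial
  identity, now spread over four consecutive basis elements.\<close>

lemma lhs_shifted_prod_inverse:
  fixes n :: nat and q a A A' p y :: complex
  assumes "q \<noteq> 0" "a \<noteq> 0"
  defines "\<phi> \<equiv> shifted_prod p q" and "X \<equiv> q ^ n" and "b \<equiv> A * p" and "b' \<equiv> A' * p"
  shows "A * A' / (q * a) * y * (y - p) * \<phi> n (y / q) + a * (1 - A * y) * (1 - A' * y) * \<phi> n (q * y)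
     - (a - (A + A' + A * A' * p / q) * y + (1 + 1 / q) * A * A' * y\<^sup>2) * \<phi> n y
   = - a * p * X / q * (1 - X) * (1 - b * X / q) * (1 - b' * X / q) * \<phi> (n - 1) y
     + ((1 - a * X) * X * (b + b' + b * b' / q - X * b * b' * (1 + 1 / q))
        - a * (1 - X) * (1 - b * X / q) * (1 - b' * X / q)) * \<phi> n y
     + (1 - a * X) / a * (A * A' * p * (1 - a * q * X)
        + a * (A + A' + A * A' * p / q - X * A * A' * p * (1 + 1 / q))) * \<phi> (n + 1) y
     + A * A' * (1 - a * X) * (1 - a * q * X) / (a * q * X) * \<phi> (n + 2) y"
proof (cases n)
  case 0
  then show ?thesis
    using assms(1,2)
    by (simp add: \<phi>_def X_def b_def b'_def shifted_prod_Suc field_simps power2_eq_square)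
next
  case (Suc m)
  define Y where "Y = q ^ m"
  have Y: "Y \<noteq> 0" and X: "X = q * Y"
    using assms(1) Suc by (simp_all add: Y_def X_def)
  have 1: "\<phi> n (q * y) = q * Y * (y - p / q) * \<phi> m y"
    using shifted_prod_mult_q[OF assms(1), of p m y] by (simp add: \<phi>_def Y_def Suc)
  have 2: "(y - p) * \<phi> n (y / q) = (y - p * q * Y) * (y - p * Y) * \<phi> m y / (q * Y)"
    using shifted_prod_div_q[OF assms(1), of y p n]
    by (simp add: \<phi>_def Y_def Suc shifted_prod_Suc mult_ac)
  have 3: "\<phi> n y = (y - p * Y) * \<phi> m y"
    by (simp add: \<phi>_def Y_def Suc shifted_prod_Suc)
  have 4: "\<phi> (n + 1) y = (y - p * q * Y) * (y - p * Y) * \<phi> m y"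
    by (simp add: \<phi>_def Y_def Suc shifted_prod_Suc mult_ac)
  have 5: "\<phi> (n + 2) y = (y - p * q * q * Y) * (y - p * q * Y) * (y - p * Y) * \<phi> m y"
    by (simp add: \<phi>_def Y_def Suc shifted_prod_Suc mult_ac)
  have "A * A' / (q * a) * y * (y - p) * \<phi> n (y / q) = A * A' / (q * a) * y * ((y - p) * \<phi> n (y / q))"
    by (simp add: mult_ac)
  also have "\<dots> = A * A' / (q * a) * y * ((y - p * q * Y) * (y - p * Y) * \<phi> m y / (q * Y))"
    by (simp only: 2)
  finally have 6: "A * A' / (q * a) * y * (y - p) * \<phi> n (y / q) = \<dots>" .
  show ?thesis
    unfolding 6 1 3 4 5 unfolding X b_def b'_def using assms(1,2) Y Suc
    by (simp add: divide_simps, simp add: algebra_simps power2_eq_square)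
qed

subsection \<open>The three-term recurrence\<close>

text \<open>The summand of \<open>c_n\<close> in (ii); the exponent \<open>-n k + k^2\<close> equals
  \<open>-k (n - k)\<close> and becomes a natural power in the denominator.\<close>

definition two_pochhammer_term :: "complex \<Rightarrow> complex \<Rightarrow> complex \<Rightarrow> nat \<Rightarrow> nat \<Rightarrow> complex" where
  "two_pochhammer_term q b r n k =
     r ^ k / (q ^ (k * (n - k)) * qpoch b q k * qpoch q q (n - k) * qpoch q q k)"

definition two_pochhammer_sum :: "complex \<Rightarrow> complex \<Rightarrow> complex \<Rightarrow> nat \<Rightarrow> complex" where
  "two_pochhammer_sum q b r n = (\<Sum>k\<le>n. two_pochhammer_term q b r n k)"

context
  fixes q b r :: complex
  assumes q: "q \<noteq> 0" "\<And>n::nat. n > 0 \<Longrightarrow> q ^ n \<noteq> 1"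
    and b: "\<And>n. qpoch b q n \<noteq> 0"
begin

private abbreviation "F \<equiv> two_pochhammer_term q b r"
private abbreviation "C \<equiv> two_pochhammer_sum q b r"

text \<open>\<open>F n k\<close> and \<open>F (Suc n) k\<close> differ by \<open>q ^ k\<close> and
  the last factor of \<open>qpoch q q (Suc n - k)\<close>. The weight \<open>w\<close> is free
  because both \<open>1\<close> and \<open>q ^ k\<close> are needed.\<close>

lemma two_pochhammer_sum_lower:
  "(\<Sum>k\<le>Suc n. w k * (1 - q ^ Suc n / q ^ k) * F (Suc n) k) = (\<Sum>k\<le>n. w k / q ^ k * F n k)"
proof -
  have "w k * (1 - q ^ Suc n / q ^ k) * F (Suc n) k = w k / q ^ k * F n k" if "k \<le> n" for k
  proof -
    obtain j where n: "n = k + j"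
      using le_Suc_ex[OF \<open>k \<le> n\<close>] by blast
    have *: "1 - q * q ^ j \<noteq> 0"
      using q(2)[of "Suc j"] by simp
    have "F (Suc n) k = F n k / (q ^ k * (1 - q * q ^ j))"
      by (simp add: n two_pochhammer_term_def Suc_diff_le qpoch_Suc power_add mult_ac)
    moreover have "1 - q ^ Suc n / q ^ k = 1 - q * q ^ j"
      using q(1) by (simp add: n power_add)
    ultimately show ?thesis
      using * by (simp only:) simp
  qed
  then have "(\<Sum>k\<le>n. w k * (1 - q ^ Suc n / q ^ k) * F (Suc n) k) = (\<Sum>k\<le>n. w k / q ^ k * F n k)"
    by (intro sum.cong) auto
  \<comment> \<open>The summand \<open>k = Suc n\<close> vanishes through
    \<open>1 - q ^ Suc n / q ^ k\<close>.\<close>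
  then show ?thesis
    using q(1) by simp
qed

text \<open>Raising \<open>n\<close> and \<open>k\<close> together keeps \<open>n - k\<close>, so
  only the last factors of the two symbols of length \<open>k\<close>, one \<open>r\<close> and a
  power of \<open>q\<close> change; \<open>1 - q ^ k\<close> kills the summand
  \<open>k = 0\<close>.\<close>

lemma two_pochhammer_sum_shift:
  "(\<Sum>k\<le>Suc n. (1 - q ^ k) * (1 - b * q ^ k / q) * (q ^ Suc n / q ^ k) * F (Suc n) k)
    = r * C n"
proof -
  have "(1 - q ^ Suc k) * (1 - b * q ^ Suc k / q) * (q ^ Suc n / q ^ Suc k) * F (Suc n) (Suc k)
      = r * F n k" if "k \<le> n" for k
  proof -
    obtain j where n: "n = k + j"
      using le_Suc_ex[OF \<open>k \<le> n\<close>] by blast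
    have *: "1 - q * q ^ k \<noteq> 0" "1 - b * q ^ k \<noteq> 0"
      using q(2)[of "Suc k"] qpoch_neq_0_factor[OF b] by simp_all
    have "F (Suc n) (Suc k) = r * F n k / (q ^ j * (1 - b * q ^ k) * (1 - q * q ^ k))"
      by (simp add: n two_pochhammer_term_def qpoch_Suc power_add mult_ac)
    moreover have "b * q ^ Suc k / q = b * q ^ k" "q ^ Suc n / q ^ Suc k = q ^ j"
      using q(1) by (simp_all add: n power_add)
    moreover have "q ^ j \<noteq> 0"
      using q(1) by simp
    ultimately show ?thesis
      using * by (simp only: power_Suc) simp
  qed
  then have "(\<Sum>k\<le>n. (1 - q ^ Suc k) * (1 - b * q ^ Suc k / q) * (q ^ Suc n / q ^ Suc k)
      * F (Suc n) (Suc k)) = r * C n"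
    unfolding two_pochhammer_sum_def sum_distrib_left by (intro sum.cong) auto
  then show ?thesis
    unfolding sum.atMost_Suc_shift by simp
qed

private definition "Cm n = (\<Sum>k\<le>n. F n k / q ^ k)"
private definition "Cp n = (\<Sum>k\<le>n. q ^ k * F n k)"

private lemma weight_inverse_rec: "C (Suc n) - q ^ Suc n * Cm (Suc n) = Cm n"
  using two_pochhammer_sum_lower[of "\<lambda>_. 1" n]
  by (simp add: two_pochhammer_sum_def Cm_def sum_subtractf sum_distrib_left algebra_simps
      del: sum.atMost_Suc)

private lemma weight_power_rec: "Cp (Suc n) - q ^ Suc n * C (Suc n) = C n"
proof -
  have "q ^ k * (1 - q ^ Suc n / q ^ k) = q ^ k - q ^ Suc n" for k
    using q(1) by (simp add: field_simps)
  then show ?thesis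
    using two_pochhammer_sum_lower[of "\<lambda>k. q ^ k" n] q(1)
    by (simp add: two_pochhammer_sum_def Cp_def sum_subtractf sum_distrib_left left_diff_distrib
      del: sum.atMost_Suc)
qed

text \<open>The weight \<open>(1 - q ^ k) * (1 - b * q ^ k / q) / q ^ k\<close> is a combination of
  \<open>1 / q ^ k\<close>, \<open>1\<close> and \<open>q ^ k\<close>, so the shift relation is
  linear in \<open>Cm\<close>, \<open>C\<close> and \<open>Cp\<close>.\<close>

private lemma shift_rec:
  "q ^ Suc n * (Cm (Suc n) - (1 + b / q) * C (Suc n) + b / q * Cp (Suc n)) = r * C n"
proof -
  have "(1 - q ^ k) * (1 - b * q ^ k / q) * (q ^ Suc n / q ^ k) * f
      = q ^ Suc n * (f / q ^ k - (1 + b / q) * f + b / q * (q ^ k * f))" for k and f :: complex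
    using q(1) by (simp add: field_simps)
  then have "(\<Sum>k\<le>Suc n. q ^ Suc n * (F (Suc n) k / q ^ k - (1 + b / q) * F (Suc n) k
      + b / q * (q ^ k * F (Suc n) k))) = r * C n"
    using two_pochhammer_sum_shift[of n] by simp
  then show ?thesis
    unfolding two_pochhammer_sum_def[of q b r "Suc n"] Cm_def Cp_def
    by (simp add: sum_distrib_left sum.distrib sum_subtractf distrib_left right_diff_distrib
        del: sum.atMost_Suc)
qed

text \<open>This is the three-term recurrence at \<open>n = -1\<close> with
  \<open>C (-1) = 0\<close>; here \<open>Cm 0 = C 0\<close> closes the system.\<close>

lemma two_pochhammer_sum_rec_0: "(1 - q) * (1 - b) * C 1 = (r + 1 - b) * C 0"
proof -
  have Cm0: "Cm 0 = C 0"
    by (simp add: Cm_def two_pochhammer_sum_def)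
  have "Cp 1 = q * C 1 + C 0" and Cm1: "q * Cm 1 = C 1 - C 0"
    using weight_inverse_rec[of 0] weight_power_rec[of 0] Cm0 by (simp_all add: algebra_simps)
  moreover have "q * Cm 1 - (q + b) * C 1 + b * Cp 1 = r * C 0"
  proof -
    have "q * (x - (1 + b / q) * y + b / q * z) = q * x - (q + b) * y + b * z" for x y z
      using q(1) by (simp add: field_simps)
    then show ?thesis
      using shift_rec[of 0] by simp
  qed
  ultimately have "C 1 - C 0 - (q + b) * C 1 + b * (q * C 1 + C 0) = r * C 0"
    by simp
  then show ?thesis
    by (simp add: algebra_simps)
qed

text \<open>\<open>weight_power_rec\<close> removes \<open>Cp\<close>; \<open>shift_rec\<close> at
  two consecutive indices expresses \<open>Cm (n + 1)\<close> and \<open>Cm (n + 2)\<close> by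
  values of \<open>C\<close>, and \<open>weight_inverse_rec\<close> ties these two together.\<close>

lemma two_pochhammer_sum_rec:
  "q * q ^ n * (1 - q\<^sup>2 * q ^ n) * (1 - b * q * q ^ n) * C (n + 2)
    = q * q ^ n * (r + 1 + b / q - q ^ n * b * (1 + q)) * C (n + 1) + (r - q ^ n * b) * C n"
proof -
  define X where "X = q ^ n"
  define v where "v = b / q"
  have b_eq: "b = v * q"
    using q(1) by (simp add: v_def)
  have Cp: "Cp (n + 2) = q\<^sup>2 * X * C (n + 2) + C (n + 1)"
      "Cp (n + 1) = q * X * C (n + 1) + C n"
    and Cm: "Cm (n + 1) = C (n + 2) - q\<^sup>2 * X * Cm (n + 2)"
    using weight_inverse_rec[of "Suc n"] weight_power_rec[of "Suc n"] weight_power_rec[of n]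
    by (simp_all add: X_def power2_eq_square algebra_simps)
  have upper: "q\<^sup>2 * X * Cm (n + 2) = r * C (n + 1) + q\<^sup>2 * X * (1 + v) * C (n + 2)
      - q\<^sup>2 * X * v * (q\<^sup>2 * X * C (n + 2) + C (n + 1))"
    using shift_rec[of "Suc n", folded v_def] Cp by (simp add: X_def power2_eq_square algebra_simps)
  have lower: "q * X * Cm (n + 1) = r * C n + q * X * (1 + v) * C (n + 1)
      - q * X * v * (q * X * C (n + 1) + C n)"
    using shift_rec[of n, folded v_def] Cp by (simp add: X_def algebra_simps)
  \<comment> \<open>The elimination for arbitrary values \<open>c0\<close>, \<open>c1\<close>,
    \<open>c2\<close>, where \<open>b = v * q\<close> clears the quotient
    \<open>b / q\<close>.\<close>
  have "q * X * (1 - q\<^sup>2 * X) * (1 - b * q * X) * c2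
      = q * X * (r + 1 + v - X * b * (1 + q)) * c1 + (r - X * b) * c0"
    if "q * X * (c2 - (r * c1 + q\<^sup>2 * X * (1 + v) * c2 - q\<^sup>2 * X * v * (q\<^sup>2 * X * c2 + c1)))
      = r * c0 + q * X * (1 + v) * c1 - q * X * v * (q * X * c1 + c0)" for c0 c1 c2
    using that unfolding b_eq by (simp add: algebra_simps power2_eq_square)
  from this[OF lower[unfolded Cm upper]] have "q * X * (1 - q\<^sup>2 * X) * (1 - b * q * X) * C (n + 2)
      = q * X * (r + 1 + v - X * b * (1 + q)) * C (n + 1) + (r - X * b) * C n" .
  then show ?thesis
    by (simp add: X_def v_def)
qed

end

subsection \<open>The formal solutions\<close>

text \<open>\<open>s\<close> holds the \<open>x\<close>-free factors; its ratio is the one for which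
  the two terms of \<open>lhs_shifted_prod\<close> telescope.\<close>

lemma formal_solution_ascending:
  fixes q L P A A' B lam :: complex and s :: "nat \<Rightarrow> complex"
  defines "Q \<equiv> qpow L lam" and "\<phi> \<equiv> (\<lambda>n x. qpoch (A / x) q n * x ^ n)"
  assumes nz: "q \<noteq> 0" "A' \<noteq> 0" "B \<noteq> 0"
    and u: "\<And>n x. x \<noteq> 0 \<Longrightarrow> u n x = s n * \<phi> n x"
    and s: "\<And>n. s (Suc n) * (A' / q) * (1 - A / B * q ^ n) * (1 - q * q ^ n)
      = s n * (1 - Q * P * q ^ n)"
  shows "formal_solution q L (reduced_lhs q Q P A A' B) lam \<phi> u"
proof -
  have \<phi>: "\<phi> n x = shifted_prod A q n x" if "x \<noteq> 0" for n x
    using that by (simp add: \<phi>_def qpoch_divide_mult_power)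
  have Q: "Q \<noteq> 0"
    by (simp add: Q_def)
  define \<sigma> where "\<sigma> n = s n * ((1 - Q * P * q ^ n) / q ^ n)" for n
  define \<tau> where "\<tau> n = s n * (A' / q ^ n * (1 - q ^ n) * (1 - A / B * q ^ n / q))" for n
  have \<tau>_0: "\<tau> 0 = 0"
    by (simp add: \<tau>_def)
  have \<tau>_Suc: "\<tau> (Suc n) = \<sigma> n" for n
  proof -
    have "\<tau> (Suc n) = s (Suc n) * (A' / q) * (1 - A / B * q ^ n) * (1 - q * q ^ n) / q ^ n"
      using nz(1) by (simp add: \<tau>_def)
    then show ?thesis
      unfolding s by (simp add: \<sigma>_def)
  qed
  have term_eq: "substituted_term q L (reduced_lhs q Q P A A' B) lam (u n) x
      = (\<sigma> n * (x\<^sup>2 * \<phi> n x) - \<tau> n * (x\<^sup>2 * \<phi> (n - 1) x)) / Q" if x: "x \<noteq> 0" for n x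
  proof -
    have "substituted_term q L (reduced_lhs q Q P A A' B) lam (u n) x
      = reduced_lhs q Q P A A' B x (Q * (s n * shifted_prod A q n (q * x)))
         ((s n * shifted_prod A q n (x / q)) / Q) (s n * shifted_prod A q n x)"
      using x nz(1) by (simp add: substituted_term_def u \<phi> Q_def qpow_minus)
    also have "\<dots> = s n * (A * A' / (q * B) * (B - x) * shifted_prod A q n (q * x)
        + (x - A) * (x - A') * shifted_prod A q n (x / q)
        - (Q * P * x\<^sup>2 - (A + A' + A * A' / (q * B)) * x + (1 + 1 / q) * A * A')
          * shifted_prod A q n x) / Q"
      unfolding reduced_lhs_scaled[OF Q nz(1) nz(3)] by (simp add: algebra_simps)
    moreover have "s n * (c * y * f - c' * y * f') / Q
        = (s n * c * (y * f) - s n * c' * (y * f')) / Q" for c c' y f f'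
      by (simp add: algebra_simps)
    ultimately show ?thesis
      by (simp only: lhs_shifted_prod[OF nz(1,3)] \<phi>[OF x] \<sigma>_def \<tau>_def)
  qed
  have square: "x\<^sup>2 * \<phi> n x = \<phi> (n + 2) x + A * (1 + q) * q ^ n * \<phi> (n + 1) x
      + A\<^sup>2 * (q ^ n)\<^sup>2 * \<phi> n x" if "x \<noteq> 0" for n x
    using square_mult_shifted_prod that by (simp add: \<phi>)
  \<comment> \<open>The telescoping \<open>\<tau> (Suc n) = \<sigma> n\<close> lives in the family
    \<open>x\<^sup>2 * \<phi> n\<close>; \<open>square\<close> transfers it to the basis
    \<open>\<phi>\<close>. At \<open>n = 0\<close> the truncated \<open>n - 1\<close> is harmless as
    \<open>\<tau> 0 = 0\<close>.\<close>
  define w0 where "w0 n = - \<tau> n * (A\<^sup>2 * (q ^ (n - 1))\<^sup>2) / Q" for n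
  define w1 where
    "w1 n = (\<sigma> n * (A\<^sup>2 * (q ^ n)\<^sup>2) - \<tau> n * (A * (1 + q) * q ^ (n - 1))) / Q" for n
  define w2 where "w2 n = (\<sigma> n * (A * (1 + q) * q ^ n) - \<tau> n) / Q" for n
  define w3 where "w3 n = \<sigma> n / Q" for n
  have "coefficients_cancel \<phi> (\<lambda>n. substituted_term q L (reduced_lhs q Q P A A' B) lam (u n))"
  proof (rule coefficients_cancelI[of _ w0 _ w1 w2 w3])
    show "substituted_term q L (reduced_lhs q Q P A A' B) lam (u n) x = w0 n * \<phi> (n - 1) x
        + w1 n * \<phi> n x + w2 n * \<phi> (n + 1) x + w3 n * \<phi> (n + 2) x" if "x \<noteq> 0" for n x
      unfolding term_eq[OF that] square[OF that] w0_def w1_def w2_def w3_def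
      using Q \<tau>_0 by (cases n) (simp_all add: field_simps)
  qed (simp_all add: w0_def w1_def w2_def w3_def \<tau>_0 \<tau>_Suc numeral_2_eq_2 numeral_3_eq_3
      diff_divide_distrib del: power_Suc)
  moreover have "graded_in_x \<phi>"
    unfolding graded_in_x_def using shifted_prod_poly[of _ A q] \<phi> by metis
  ultimately show ?thesis
    unfolding formal_solution_def using u by blast
qed

text \<open>The recurrence of \<open>g\<close> gives the contributions to one basis coefficient a
  common factor, and the recurrence of \<open>c\<close> makes the remaining combination
  vanish.\<close>

lemma formal_solution_descending:
  fixes q L A A' B \<alpha>1 Q :: complex and c g :: "nat \<Rightarrow> complex"
  defines "P \<equiv> qpow L \<alpha>1" and "\<phi> \<equiv> (\<lambda>n x. qpoch (x / B) q n * (1 / x) ^ n)"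
    and "a \<equiv> Q * qpow L \<alpha>1"
  assumes nz: "q \<noteq> 0" "Q \<noteq> 0" "A' \<noteq> 0" "B \<noteq> 0"
    and u: "\<And>n x. x \<noteq> 0 \<Longrightarrow> u n x = c n * g n * \<phi> n x"
    and g: "\<And>n. g (Suc n) * a * (1 - A' / B * q ^ n) = g n * A' * (1 - a * q ^ n)"
    and c0: "(1 - q) * (1 - A / B) * c 1 = (A / A' + 1 - A / B) * c 0"
    and c: "\<And>n. q * q ^ n * (1 - q\<^sup>2 * q ^ n) * (1 - A / B * q * q ^ n) * c (n + 2)
      = q * q ^ n * (A / A' + 1 + A / B / q - q ^ n * (A / B) * (1 + q)) * c (n + 1)
        + (A / A' - q ^ n * (A / B)) * c n"
  shows "formal_solution q L (reduced_lhs q Q P A A' B) (- \<alpha>1) \<phi> u"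
proof -
  have \<phi>: "\<phi> n x = shifted_prod (1 / B) q n (1 / x)" if "x \<noteq> 0" for n x
    using that qpoch_divide_mult_power[of "1 / x" "1 / B" q n] by (simp add: \<phi>_def)
  have P: "P \<noteq> 0" and a: "a = Q * P" "a \<noteq> 0"
    using nz by (simp_all add: P_def a_def)
  define p where "p = 1 / B"
  define r where "r = A / A'"
  have A: "A = r * A'" and Bp: "z / B = z * p" for z
    using nz by (simp_all add: r_def p_def)
  define w0 where "w0 n = c n * g n / Q * (- a * p * q ^ n / q * (1 - q ^ n)
     * (1 - A * p * q ^ n / q) * (1 - A' * p * q ^ n / q))" for n
  define w1 where "w1 n = c n * g n / Q *
     ((1 - a * q ^ n) * q ^ n
        * (A * p + A' * p + A * p * (A' * p) / q - q ^ n * (A * p) * (A' * p) * (1 + 1 / q))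
      - a * (1 - q ^ n) * (1 - A * p * q ^ n / q) * (1 - A' * p * q ^ n / q))" for n
  define w2 where "w2 n = c n * g n / Q * ((1 - a * q ^ n) / a * (A * A' * p * (1 - a * q * q ^ n)
        + a * (A + A' + A * A' * p / q - q ^ n * A * A' * p * (1 + 1 / q))))" for n
  define w3 where "w3 n = c n * g n / Q *
     (A * A' * (1 - a * q ^ n) * (1 - a * q * q ^ n) / (a * q * q ^ n))" for n
  note w_defs = w0_def w1_def w2_def w3_def
  have g_Suc: "g (Suc n) * a * (1 - A' * p * q ^ n) = g n * A' * (1 - a * q ^ n)" for n
    using g[of n] by (simp only: Bp)
  define b' where "b' = A' * p"
  have b: "A / B = r * b'" "A * p = r * b'"
    by (simp_all add: Bp A b'_def)
  have c_1: "(1 - q) * (1 - r * b') * c 1 = (r + 1 - r * b') * c 0"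
    using c0 unfolding b r_def[symmetric] .
  have c_rec: "q * q ^ n * (1 - q\<^sup>2 * q ^ n) * (1 - r * b' * q * q ^ n) * c (n + 2)
      = q * q ^ n * (r + 1 + r * b' / q - q ^ n * (r * b') * (1 + q)) * c (n + 1)
        + (r - q ^ n * (r * b')) * c n" for n
    using c[of n] unfolding b r_def[symmetric] .
  \<comment> \<open>The last factor has the form of the left side of \<open>c_rec\<close>, so it can
    be rewritten there.\<close>
  have w0_Suc: "w0 (Suc n) = - b' * (1 - a * q ^ n) * (g n / Q)
      * (q ^ n * (1 - q * q ^ n) * (1 - r * b' * q ^ n) * c (Suc n))" for n
  proof -
    have "w0 (Suc n) = - p * (g (Suc n) * a * (1 - A' * p * q ^ n)) / Q
        * (q ^ n * (1 - q * q ^ n) * (1 - A * p * q ^ n) * c (Suc n))"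
      using nz(1) by (simp add: w0_def mult_ac)
    also have "\<dots> = - p * (g n * A' * (1 - a * q ^ n)) / Q
        * (q ^ n * (1 - q * q ^ n) * (1 - A * p * q ^ n) * c (Suc n))"
      by (simp only: g_Suc)
    finally show ?thesis
      by (simp add: b b'_def mult_ac)
  qed
  \<comment> \<open>The part with factor \<open>a\<close> contains such a left side up to a power of
    \<open>q\<close>; the other part stays a multiple of \<open>c (Suc n)\<close>.\<close>
  have w1_Suc: "w1 (Suc n) = g (Suc n) / Q * (
      (1 - a * q * q ^ n) * q * q ^ n
        * (r * b' + b' + r * b' * b' / q - q ^ n * (r * b') * b' * (1 + q)) * c (Suc n)
      - a * (1 - b' * q ^ n) * ((1 - q * q ^ n) * (1 - r * b' * q ^ n) * c (Suc n)))" for n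
    using nz(1,2) unfolding w1_def b b'_def[symmetric] by (simp add: field_simps)
  have w2_eq: "w2 n = g (Suc n) / Q * (1 - b' * q ^ n) * (r * b' * (1 - a * q * q ^ n)
      + a * (r + 1 + r * b' / q - q ^ n * (r * b') * (1 + 1 / q))) * c n" for n
  proof -
    have "w2 n = g n * A' * (1 - a * q ^ n) / (a * Q) * (r * b' * (1 - a * q * q ^ n)
      + a * (r + 1 + r * b' / q - q ^ n * (r * b') * (1 + 1 / q))) * c n"
      using nz(1,2) a(2) unfolding w2_def A b'_def by (simp add: field_simps)
    then show ?thesis
      unfolding g_Suc[symmetric] b'_def using a(2) by simp
  qed
  have w3_eq: "w3 n = g (n + 2) / Q * (1 - b' * q * q ^ n) * (a / (q * q ^ n))
      * (r * (1 - b' * q ^ n) * c n)" for n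
  proof -
    have "w3 n = g n * A' * (1 - a * q ^ n) * (1 - a * q * q ^ n) * r * A'
        / (a * q * q ^ n * Q) * c n"
      unfolding w3_def A by (simp add: mult_ac)
    also have "\<dots> = g (Suc n) * A' * (1 - a * q ^ Suc n) * (1 - b' * q ^ n) * r
        / (q * q ^ n * Q) * c n"
      unfolding g_Suc[of n, symmetric] b'_def using a(2) by (simp add: mult_ac)
    also have "\<dots> = g (n + 2) * a * (1 - A' * p * q ^ Suc n) * (1 - b' * q ^ n) * r
        / (q * q ^ n * Q) * c n"
      by (simp only: g_Suc[of "Suc n", symmetric] add_2_eq_Suc')
    finally show ?thesis
      by (simp add: b'_def mult_ac)
  qed
  have term_eq: "substituted_term q L (reduced_lhs q Q P A A' B) (- \<alpha>1) (u n) x / x\<^sup>2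
      = w0 n * \<phi> (n - 1) x + w1 n * \<phi> n x + w2 n * \<phi> (n + 1) x + w3 n * \<phi> (n + 2) x"
    if x: "x \<noteq> 0" for n x
  proof -
    define y where "y = 1 / x"
    \<comment> \<open>Under \<open>y = 1 / x\<close> the shifts \<open>q * x\<close> and
      \<open>x / q\<close> exchange roles.\<close>
    have "substituted_term q L (reduced_lhs q Q P A A' B) (- \<alpha>1) (u n) x / x\<^sup>2
      = reduced_lhs q Q P A A' B x ((c n * g n * shifted_prod p q n (y / q)) / P)
         (P * (c n * g n * shifted_prod p q n (q * y))) (c n * g n * shifted_prod p q n y) / x\<^sup>2"
      using x nz(1) by (simp add: substituted_term_def u \<phi> P_def p_def y_def qpow_minus mult_ac)
    also have "\<dots> = c n * g n / Q * (A * A' / (q * a) * y * (y - p) * shifted_prod p q n (y / q)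
        + a * (1 - A * y) * (1 - A' * y) * shifted_prod p q n (q * y)
        - (a - (A + A' + A * A' * p / q) * y + (1 + 1 / q) * A * A' * y\<^sup>2)
          * shifted_prod p q n y)"
      unfolding reduced_lhs_scaled_inverse[OF nz(2) P nz(1,4) x] y_def p_def a(1)
      by (simp add: algebra_simps diff_divide_distrib add_divide_distrib)
    moreover have "z * (v0 * f0 + v1 * f1 + v2 * f2 + v3 * f3)
        = z * v0 * f0 + z * v1 * f1 + z * v2 * f2 + z * v3 * f3" for z v0 v1 v2 v3 f0 f1 f2 f3 :: complex
      by (simp add: algebra_simps)
    ultimately show ?thesis
      by (simp only: lhs_shifted_prod_inverse[OF nz(1) a(2)] w_defs \<phi>[OF x, folded p_def y_def])
  qed
  \<comment> \<open>At the two lowest coefficients \<open>c_1\<close> replaces \<open>c_rec\<close>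
    at the index \<open>-1\<close>.\<close>
  have "w0 1 + w1 0 = 0"
  proof -
    have 1: "w0 1 = - b' * (1 - a) * (g 0 / Q) * ((1 - q) * (1 - r * b') * c 1)"
      using w0_Suc[of 0] by simp
    show ?thesis
      unfolding 1 c_1 w1_def b b'_def[symmetric] using nz(1,2) by (simp add: field_simps)
  qed
  moreover have "w0 2 + w1 1 + w2 0 = 0"
  proof -
    have 1: "w0 2 = - b' * (1 - a * q) * (g 1 / Q)
        * (q * (1 - q\<^sup>2) * (1 - r * b' * q) * c 2)"
      using w0_Suc[of 1] by (simp add: numeral_2_eq_2)
    have 2: "q * (1 - q\<^sup>2) * (1 - r * b' * q) * c 2
        = q * (r + 1 + r * b' / q - r * b' * (1 + q)) * c 1 + (r - r * b') * c 0"
      using c_rec[of 0] by (simp add: numeral_2_eq_2)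
    have 3: "w1 1 = g 1 / Q * ((1 - a * q) * q
          * (r * b' + b' + r * b' * b' / q - r * b' * b' * (1 + q)) * c 1
        - a * (1 - b') * ((1 - q) * (1 - r * b') * c 1))"
      using w1_Suc[of 0] by simp
    have 4: "w2 0 = g 1 / Q * (1 - b') * (r * b' * (1 - a * q)
        + a * (r + 1 + r * b' / q - r * b' * (1 + 1 / q))) * c 0"
      using w2_eq[of 0] by simp
    show ?thesis
      unfolding 1 2 3 4 c_1 using nz(1,2) by (simp add: field_simps)
  qed
  \<comment> \<open>All four contributions carry \<open>g (n + 2) / Q\<close>. The recurrence at
    \<open>n + 1\<close> removes \<open>c (n + 3)\<close>, the one at \<open>n\<close> rewrites the
    part of \<open>w1\<close> with factor \<open>a\<close>; then the coefficients of
    \<open>c (n + 2)\<close>, \<open>c (n + 1)\<close> and \<open>c n\<close> cancel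
    separately.\<close>
  moreover have "w0 (n + 3) + w1 (n + 2) + w2 (n + 1) + w3 n = 0" for n
  proof -
    define X where "X = q ^ n"
    have X: "X \<noteq> 0"
      using nz(1) by (simp add: X_def)
    have 1: "w0 (n + 3) = - b' * (1 - a * q\<^sup>2 * X) * (g (n + 2) / Q)
        * (q\<^sup>2 * X * (1 - q ^ 3 * X) * (1 - r * b' * q\<^sup>2 * X) * c (n + 3))"
      using w0_Suc[of "n + 2"] by (simp add: X_def eval_nat_numeral mult_ac)
    have 2: "q\<^sup>2 * X * (1 - q ^ 3 * X) * (1 - r * b' * q\<^sup>2 * X) * c (n + 3)
        = q\<^sup>2 * X * (r + 1 + r * b' / q - q * X * (r * b') * (1 + q)) * c (n + 2)
          + (r - q * X * (r * b')) * c (n + 1)"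
      using c_rec[of "n + 1"] by (simp add: X_def eval_nat_numeral mult_ac)
    have 3: "w1 (n + 2) = g (n + 2) / Q * (
        (1 - a * q\<^sup>2 * X) * q\<^sup>2 * X
          * (r * b' + b' + r * b' * b' / q - q * X * (r * b') * b' * (1 + q)) * c (n + 2)
        - a * (1 - b' * q * X) / (q * X)
          * (q * X * (1 - q\<^sup>2 * X) * (1 - r * b' * q * X) * c (n + 2)))"
      using w1_Suc[of "n + 1"] X nz(1) by (simp add: X_def eval_nat_numeral mult_ac)
    have 4: "q * X * (1 - q\<^sup>2 * X) * (1 - r * b' * q * X) * c (n + 2)
        = q * X * (r + 1 + r * b' / q - X * (r * b') * (1 + q)) * c (n + 1)
          + (r - X * (r * b')) * c n"
      using c_rec[of n] by (simp add: X_def)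
    have 5: "w2 (n + 1) = g (n + 2) / Q * (1 - b' * q * X) * (r * b' * (1 - a * q\<^sup>2 * X)
        + a * (r + 1 + r * b' / q - q * X * (r * b') * (1 + 1 / q))) * c (n + 1)"
      using w2_eq[of "n + 1"] by (simp add: X_def eval_nat_numeral mult_ac)
    show ?thesis
      unfolding 1 2 3 4 5 w3_eq X_def[symmetric] using nz(1,2) X
      by (simp add: field_simps power2_eq_square)
  qed
  ultimately have "coefficients_cancel \<phi>
      (\<lambda>n x. substituted_term q L (reduced_lhs q Q P A A' B) (- \<alpha>1) (u n) x / x\<^sup>2)"
    by (intro coefficients_cancelI[of _ w0 _ w1 w2 w3] term_eq) (simp_all add: w0_def)
  moreover have "graded_in_inverse_x \<phi>"
    unfolding graded_in_inverse_x_def using shifted_prod_poly[of _ "1 / B" q] \<phi> by metis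
  ultimately show ?thesis
    unfolding formal_solution_def using u by (intro conjI exI[of _ "\<lambda>n. c n * g n"]) auto
qed

theorem theorem3p2:
  fixes q L l1 \<alpha>1 lam :: complex and h t :: "nat \<Rightarrow> complex"
  assumes log_q: "exp L = q"
    and not_root_of_unity: "\<And>n::nat. n > 0 \<Longrightarrow> q ^ n \<noteq> 1"
    and t_nonzero: "t 1 \<noteq> 0" "t 2 \<noteq> 0"
  defines "E \<equiv> singly_confluent_lhs q L (h 1) (h 2) l1 \<alpha>1 lam (t 1) (t 2)"
  shows
    "(\<forall>i i'. (i, i') \<in> {(1, 2), (2, 1)} \<longrightarrow>
        (\<forall>n. qpoch (qpow L (h i - l1 + 1) * t i / t 1) q n \<noteq> 0) \<longrightarrow>
        (let u = (\<lambda>n x.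
               qpoch (qpow L (lam + \<alpha>1)) q n
               / (qpoch (qpow L (h i - l1 + 1) * t i / t 1) q n * qpoch q q n)
               * qpoch (qpow L (h i + 1/2) * t i / x) q n
               * (x / (qpow L (h i' - 1/2) * t i')) ^ n)
         in formal_solution q L E lam
              (\<lambda>n x. qpoch (qpow L (h i + 1/2) * t i / x) q n * x ^ n) u
            \<and> (\<forall>n x. x \<noteq> 0 \<longrightarrow>
                 u n x = basic_hyp_term
                   [qpow L (lam + \<alpha>1), qpow L (h i + 1/2) * t i / x]
                   [qpow L (h i - l1 + 1) * t i / t 1]
                   q (x / (qpow L (h i' - 1/2) * t i')) n)))
     \<and>
     ((\<forall>n. qpoch (qpow L (1 + h 2 - l1) * t 2 / t 1) q n \<noteq> 0) \<longrightarrow>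
      (\<forall>n. qpoch (qpow L (h 1 - l1 + 1)) q n \<noteq> 0) \<longrightarrow>
      (let c = (\<lambda>n. \<Sum>k=0..n.
             qpow L (- (of_nat n * of_nat k) + (of_nat k)\<^sup>2)
             * (1 / (qpoch (qpow L (h 1 - l1 + 1)) q k * qpoch q q (n - k) * qpoch q q k))
             * (qpow L (h 1 - h 2) * t 1 / t 2) ^ k);
           u = (\<lambda>n x.
             c n * (qpoch (qpow L (lam + \<alpha>1)) q n
                    / qpoch (qpow L (1 + h 2 - l1) * t 2 / t 1) q n)
             * qpoch (x / (qpow L (l1 - 1/2) * t 1)) q n
             * (qpow L (- lam - \<alpha>1 + h 2 + 1/2) * t 2 / x) ^ n)
       in formal_solution q L E (- \<alpha>1)
            (\<lambda>n x. qpoch (x / (qpow L (l1 - 1/2) * t 1)) q n * (1 / x) ^ n) u))"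
proof (intro conjI impI allI)

  \<comment> \<open>Passage to the parameters \<open>A\<close>, \<open>B\<close>, \<open>Q\<close>,
    \<open>P\<close>\<close>
  have q: "q \<noteq> 0"
    using log_q by auto
  have qn: "1 - q * q ^ n \<noteq> 0" for n
    using not_root_of_unity[of "Suc n"] by simp
  define A where "A i = qpow L (h i + 1/2) * t i" for i
  define B where "B = qpow L (l1 - 1/2) * t 1"
  define Q where "Q = qpow L lam"
  define P where "P = qpow L \<alpha>1"
  have E: "E = reduced_lhs q Q P (A 1) (A 2) B"
    unfolding E_def A_def B_def Q_def P_def using log_q t_nonzero
    by (intro singly_confluent_lhs_eq_reduced)
  have B: "B \<noteq> 0"
    using t_nonzero by (simp add: B_def)
  have QP: "qpow L (lam + \<alpha>1) = Q * P"
    by (simp add: Q_def P_def qpow_add)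
  have AB: "A i / B = qpow L (h i - l1 + 1) * t i / t 1" for i
  proof -
    have "qpow L (h i + 1/2) / qpow L (l1 - 1/2) = qpow L (h i - l1 + 1)"
      unfolding qpow_diff[symmetric] by (simp add: algebra_simps)
    then show ?thesis
      by (simp add: A_def B_def mult.assoc flip: times_divide_times_eq)
  qed
  {

    \<comment> \<open>The two solutions of (i)\<close>
    fix i i' :: nat
    assume ii': "(i, i') \<in> {(1, 2), (2, 1)}"
      and "\<forall>n. qpoch (qpow L (h i - l1 + 1) * t i / t 1) q n \<noteq> 0"
    then have den: "qpoch (A i / B) q n \<noteq> 0" for n
      by (simp add: AB)
    have t: "t i' \<noteq> 0" and A': "A i' \<noteq> 0"
      using ii' t_nonzero by (auto simp: A_def)
    \<comment> \<open>The normal form is symmetric in its two \<open>A\<close> parameters, which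
      covers both choices of \<open>(i, i')\<close> at once.\<close>
    have E': "E = reduced_lhs q Q P (A i) (A i') B"
      using ii' E reduced_lhs_commute by auto
    have arg: "qpow L (h i' - 1/2) * t i' = A i' / q"
    proof -
      have "qpow L (h i' + 1/2) / qpow L 1 = qpow L (h i' - 1/2)"
        unfolding qpow_diff[symmetric] by (simp add: algebra_simps)
      then show ?thesis
        using log_q by (simp add: A_def qpow_1 flip: \<open>qpow L (h i' + 1/2) / qpow L 1 = _\<close>)
    qed
    define s where
      "s n = qpoch (Q * P) q n / (qpoch (A i / B) q n * qpoch q q n) * (q / A i') ^ n" for n
    have s: "s (Suc n) * (A i' / q) * (1 - A i / B * q ^ n) * (1 - q * q ^ n)
        = s n * (1 - Q * P * q ^ n)" for n
    proof -
      have "1 - A i / B * q ^ n \<noteq> 0"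
        using qpoch_neq_0_factor[OF den] .
      then show ?thesis
        using q A' B qn[of n] by (simp add: s_def qpoch_Suc)
    qed
    have sol: "formal_solution q L E lam (\<lambda>n x. qpoch (A i / x) q n * x ^ n)
      (\<lambda>n x. qpoch (Q * P) q n / (qpoch (A i / B) q n * qpoch q q n)
         * qpoch (A i / x) q n * (x / (A i' / q)) ^ n)"
      unfolding E' Q_def
    proof (rule formal_solution_ascending[OF q A' B _ s[unfolded Q_def]])
      show "qpoch (qpow L lam * P) q n / (qpoch (A i / B) q n * qpoch q q n)
         * qpoch (A i / x) q n * (x / (A i' / q)) ^ n
        = s n * (qpoch (A i / x) q n * x ^ n)" for n x
        by (simp add: s_def Q_def power_divide power_mult_distrib)
    qed
    show "let u = (\<lambda>n x.
               qpoch (qpow L (lam + \<alpha>1)) q n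
               / (qpoch (qpow L (h i - l1 + 1) * t i / t 1) q n * qpoch q q n)
               * qpoch (qpow L (h i + 1/2) * t i / x) q n
               * (x / (qpow L (h i' - 1/2) * t i')) ^ n)
         in formal_solution q L E lam
              (\<lambda>n x. qpoch (qpow L (h i + 1/2) * t i / x) q n * x ^ n) u
            \<and> (\<forall>n x. x \<noteq> 0 \<longrightarrow>
                 u n x = basic_hyp_term
                   [qpow L (lam + \<alpha>1), qpow L (h i + 1/2) * t i / x]
                   [qpow L (h i - l1 + 1) * t i / t 1]
                   q (x / (qpow L (h i' - 1/2) * t i')) n)"
      unfolding Let_def
    proof (intro conjI allI impI)
      show "formal_solution q L E lam
        (\<lambda>n x. qpoch (qpow L (h i + 1/2) * t i / x) q n * x ^ n)
        (\<lambda>n x. qpoch (qpow L (lam + \<alpha>1)) q n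
               / (qpoch (qpow L (h i - l1 + 1) * t i / t 1) q n * qpoch q q n)
               * qpoch (qpow L (h i + 1/2) * t i / x) q n
               * (x / (qpow L (h i' - 1/2) * t i')) ^ n)"
        using sol unfolding AB QP[symmetric] arg[symmetric] unfolding A_def .
    \<comment> \<open>With two upper parameters and one lower, the exponent of the sign factor is
      \<open>1 + 1 - 2 = 0\<close>.\<close>
    qed (simp add: basic_hyp_term_def)
  next

    \<comment> \<open>The solution of (ii)\<close>
    assume "\<forall>n. qpoch (qpow L (1 + h 2 - l1) * t 2 / t 1) q n \<noteq> 0"
      and "\<forall>n. qpoch (qpow L (h 1 - l1 + 1)) q n \<noteq> 0"
    moreover have b': "qpow L (1 + h 2 - l1) * t 2 / t 1 = A 2 / B"
      by (simp add: AB algebra_simps)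
    moreover have b: "qpow L (h 1 - l1 + 1) = A 1 / B"
      using t_nonzero by (simp add: AB)
    ultimately have den': "qpoch (A 2 / B) q n \<noteq> 0" and den: "qpoch (A 1 / B) q n \<noteq> 0" for n
      by simp_all
    have A': "A 2 \<noteq> 0"
      using t_nonzero by (simp add: A_def)
    have r: "qpow L (h 1 - h 2) * t 1 / t 2 = A 1 / A 2"
      by (simp add: A_def qpow_add qpow_diff)
    have arg: "qpow L (- lam - \<alpha>1 + h 2 + 1/2) * t 2 = A 2 / (Q * P)"
    proof -
      have "- lam - \<alpha>1 + h 2 + 1/2 = (h 2 + 1/2) - (lam + \<alpha>1)"
        by simp
      then show ?thesis
        by (simp only: qpow_diff QP A_def times_divide_eq_left)
    qed
    define c where "c = two_pochhammer_sum q (A 1 / B) (A 1 / A 2)"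
    have c: "(\<Sum>k=0..n. qpow L (- (of_nat n * of_nat k) + (of_nat k)\<^sup>2)
        * (1 / (qpoch (A 1 / B) q k * qpoch q q (n - k) * qpoch q q k)) * (A 1 / A 2) ^ k) = c n"
      for n
      unfolding c_def two_pochhammer_sum_def atLeast0AtMost
    proof (intro sum.cong refl)
      fix k assume "k \<in> {..n}"
      then have "- (of_nat n * of_nat k) + (of_nat k)\<^sup>2 = - (of_nat (k * (n - k)) :: complex)"
        by (simp add: of_nat_diff power2_eq_square algebra_simps)
      then have "qpow L (- (of_nat n * of_nat k) + (of_nat k)\<^sup>2) = 1 / q ^ (k * (n - k))"
        by (simp only: qpow_minus qpow_of_nat log_q)
      then show "qpow L (- (of_nat n * of_nat k) + (of_nat k)\<^sup>2)
        * (1 / (qpoch (A 1 / B) q k * qpoch q q (n - k) * qpoch q q k)) * (A 1 / A 2) ^ k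
        = two_pochhammer_term q (A 1 / B) (A 1 / A 2) n k"
        by (simp only: two_pochhammer_term_def) (simp add: mult_ac)
    qed
    \<comment> \<open>\<open>g\<close> collects the \<open>x\<close>-free factors other than
      \<open>c n\<close>, including the constant in the \<open>n\<close>-th power.\<close>
    define g where "g n = qpoch (Q * P) q n / qpoch (A 2 / B) q n * (A 2 / (Q * P)) ^ n" for n
    have nz: "Q \<noteq> 0" "P \<noteq> 0"
      by (simp_all add: Q_def P_def)
    have g: "g (Suc n) * (Q * P) * (1 - A 2 / B * q ^ n) = g n * A 2 * (1 - Q * P * q ^ n)" for n
    proof -
      have "1 - A 2 / B * q ^ n \<noteq> 0"
        using qpoch_neq_0_factor[OF den'] .
      then show ?thesis
        using nz by (simp add: g_def qpoch_Suc)
    qed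
    have sol: "formal_solution q L E (- \<alpha>1) (\<lambda>n x. qpoch (x / B) q n * (1 / x) ^ n)
      (\<lambda>n x. c n * (qpoch (Q * P) q n / qpoch (A 2 / B) q n) * qpoch (x / B) q n
        * (A 2 / (Q * P) / x) ^ n)"
      unfolding E P_def
    proof (rule formal_solution_descending[OF q nz(1) A' B _ g[unfolded P_def]])
      show "c n * (qpoch (Q * qpow L \<alpha>1) q n / qpoch (A 2 / B) q n) * qpoch (x / B) q n
        * (A 2 / (Q * qpow L \<alpha>1) / x) ^ n = c n * g n * (qpoch (x / B) q n * (1 / x) ^ n)" for n x
        by (simp add: g_def P_def power_divide power_mult_distrib mult_ac)
    qed (use two_pochhammer_sum_rec_0[OF q not_root_of_unity den]
          two_pochhammer_sum_rec[OF q not_root_of_unity den] in \<open>simp_all only: c_def\<close>)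
    show "let c = (\<lambda>n. \<Sum>k=0..n.
             qpow L (- (of_nat n * of_nat k) + (of_nat k)\<^sup>2)
             * (1 / (qpoch (qpow L (h 1 - l1 + 1)) q k * qpoch q q (n - k) * qpoch q q k))
             * (qpow L (h 1 - h 2) * t 1 / t 2) ^ k);
           u = (\<lambda>n x.
             c n * (qpoch (qpow L (lam + \<alpha>1)) q n
                    / qpoch (qpow L (1 + h 2 - l1) * t 2 / t 1) q n)
             * qpoch (x / (qpow L (l1 - 1/2) * t 1)) q n
             * (qpow L (- lam - \<alpha>1 + h 2 + 1/2) * t 2 / x) ^ n)
       in formal_solution q L E (- \<alpha>1)
            (\<lambda>n x. qpoch (x / (qpow L (l1 - 1/2) * t 1)) q n * (1 / x) ^ n) u"
      using sol unfolding Let_def b b' r arg QP c B_def[symmetric] .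
  }
qed

end
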